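(* Let $v$ and $w$ be values, $E$ a term and $x$ a $\lambda$-variable. If $v\equiv w$ then $E[x:=v]\equiv E[x:=w]$.
   Context: Fix pairwise disjoint countably infinite sets of $\lambda$-variables ($x,y,\dots$), stack variables ($\alpha,\beta,\dots$), term variables ($a,b,\dots$), and countable sets of labels $l$ and constructors $C$. Values, terms, stacks, processes: $v,w::=x\mid\lambda x\,t\mid C[v]\mid\{l_i=v_i\}_{i\in I}$; $t,u::=a\mid v\mid t\,u\mid\mu\alpha\,t\mid p\mid v.l\mid\mathrm{case}_v[C_i[x_i]\to t_i]_{i\in I}\mid\delta_{v,w}$; $\pi::=\alpha\mid v.\pi\mid[t]\pi$; $p::=t\ast\pi$; $I$ finite; $\lambda x$, $\mu\alpha$ and the $x_i$ in case branches are binders, term variables are never bound. Substitutions map $\lambda$-variables to values, stack variables to stacks, term variables to terms (capture-avoiding). $\succ$ is the smallest relation on processes with: $t\,u\ast\pi\succ u\ast[t]\pi$; $v\ast[t]\pi\succ t\ast v.\pi$; $\lambda x\,t\ast v.\pi\succ t[x:=v]\ast\pi$; $\mu\alpha\,t\ast\pi\succ t[\alpha:=\pi]\ast\pi$; $p\ast\pi\succ p$; $\{l_i=v_i\}_{i\in I}.l_k\ast\pi\succ v_k\ast\pi$ ($k\in I$); $\mathrm{case}_{C_k[v]}[C_i[x_i]\to t_i]_{i\in I}\ast\pi\succ t_k[x_k:=v]\ast\pi$ ($k\in I$). A process is final if it is $v\ast\alpha$ with $v$ a value and $\alpha$ a stack variable; for a relation $R$, $p\Downarrow_R$ means $p\,R^*\,q$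 with $q$ final. For $i\in\mathbb N$, inductively: $\rightsquigarrow_i=\succ\cup\{(\delta_{v,w}\ast\pi,v\ast\pi)\mid\exists j<i,\ v\not\equiv_jw\}$; $t\equiv_iu$ iff for all $j\le i$, stacks $\pi$, substitutions $\sigma$: $t\sigma\ast\pi\Downarrow_{\rightsquigarrow_j}\Leftrightarrow u\sigma\ast\pi\Downarrow_{\rightsquigarrow_j}$; $\not\equiv_i$ is its negation. $\equiv=\bigcap_i\equiv_i$. *)

theory Defs
  imports "HOL-Library.Finite_Map" "HOL-Library.Countable"
begin

text \<open>
  Terms are taken up to renaming of bound variables, using de Bruijn indices. There are two
  independent index spaces, one for \<open>\<lambda>\<close>-variables (bound by \<open>Lam\<close> and by each branch of \<open>Case\<close>)
  and one for stack variables (bound by \<open>Mu\<close>). An index \<open>n\<close> in the scope of \<open>k\<close> binders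
  of its kind with \<open>n \<ge> k\<close> denotes the free variable number \<open>n - k\<close>. Term variables are never
  bound, hence are plain names.

  Labels and constructors are drawn from the types \<open>'l\<close> and \<open>'c\<close>. A finite family
  \<open>(l\<^sub>i = v\<^sub>i)\<^sub>i\<close> or \<open>(C\<^sub>i[x\<^sub>i] \<rightarrow> t\<^sub>i)\<^sub>i\<close> with distinct keys is a finite map.
\<close>

datatype ('l, 'c) val =
    Var nat
  | Lam "('l, 'c) trm"
  | Con 'c "('l, 'c) val"
  | Rec "('l, ('l, 'c) val) fmap"
and ('l, 'c) trm =
    TVar nat
  | Val "('l, 'c) val"
  | App "('l, 'c) trm" "('l, 'c) trm"
  | Mu "('l, 'c) trm"
  | Prc "('l, 'c) prc"
  | Proj "('l, 'c) val" 'l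
  | Case "('l, 'c) val" "('c, ('l, 'c) trm) fmap"
  | Delta "('l, 'c) val" "('l, 'c) val"
and ('l, 'c) stk =
    SVar nat
  | Push "('l, 'c) val" "('l, 'c) stk"
  | Frame "('l, 'c) trm" "('l, 'c) stk"
and ('l, 'c) prc =
    Proc "('l, 'c) trm" "('l, 'c) stk"  (infix \<open>\<star>\<close> 60)

text \<open>
  Renaming of \<open>\<lambda>\<close>-variables by \<open>f\<close> and of stack variables by \<open>g\<close>; it is only used to shift
  indices when a substitution is pushed under a binder.
\<close>

definition up :: "(nat \<Rightarrow> nat) \<Rightarrow> nat \<Rightarrow> nat" where
  "up f = case_nat 0 (\<lambda>n. Suc (f n))"

primrec ren_val :: "(nat \<Rightarrow> nat) \<Rightarrow> (nat \<Rightarrow> nat) \<Rightarrow> ('l, 'c) val \<Rightarrow> ('l, 'c) val"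
  and ren_trm :: "(nat \<Rightarrow> nat) \<Rightarrow> (nat \<Rightarrow> nat) \<Rightarrow> ('l, 'c) trm \<Rightarrow> ('l, 'c) trm"
  and ren_stk :: "(nat \<Rightarrow> nat) \<Rightarrow> (nat \<Rightarrow> nat) \<Rightarrow> ('l, 'c) stk \<Rightarrow> ('l, 'c) stk"
  and ren_prc :: "(nat \<Rightarrow> nat) \<Rightarrow> (nat \<Rightarrow> nat) \<Rightarrow> ('l, 'c) prc \<Rightarrow> ('l, 'c) prc"
where
  "ren_val f g (Var x) = Var (f x)"
| "ren_val f g (Lam t) = Lam (ren_trm (up f) g t)"
| "ren_val f g (Con C v) = Con C (ren_val f g v)"
| "ren_val f g (Rec r) = Rec (fmmap (ren_val f g) r)"
| "ren_trm f g (TVar a) = TVar a"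
| "ren_trm f g (Val v) = Val (ren_val f g v)"
| "ren_trm f g (App t u) = App (ren_trm f g t) (ren_trm f g u)"
| "ren_trm f g (Mu t) = Mu (ren_trm f (up g) t)"
| "ren_trm f g (Prc p) = Prc (ren_prc f g p)"
| "ren_trm f g (Proj v l) = Proj (ren_val f g v) l"
| "ren_trm f g (Case v bs) = Case (ren_val f g v) (fmmap (ren_trm (up f) g) bs)"
| "ren_trm f g (Delta v w) = Delta (ren_val f g v) (ren_val f g w)"
| "ren_stk f g (SVar \<alpha>) = SVar (g \<alpha>)"
| "ren_stk f g (Push v \<pi>) = Push (ren_val f g v) (ren_stk f g \<pi>)"
| "ren_stk f g (Frame t \<pi>) = Frame (ren_trm f g t) (ren_stk f g \<pi>)"
| "ren_prc f g (t \<star> \<pi>) = ren_trm f g t \<star> ren_stk f g \<pi>"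

text \<open>
  A substitution maps \<open>\<lambda>\<close>-variables to values, stack variables to stacks and term variables to
  terms. Substitutions are total maps applied simultaneously and need not have finite support.
\<close>

datatype ('l, 'c) subst =
  Subst (lv: "nat \<Rightarrow> ('l, 'c) val") (sv: "nat \<Rightarrow> ('l, 'c) stk") (tv: "nat \<Rightarrow> ('l, 'c) trm")

definition up_lv :: "('l, 'c) subst \<Rightarrow> ('l, 'c) subst" where
  "up_lv \<sigma> = Subst
     (case_nat (Var 0) (\<lambda>x. ren_val Suc id (lv \<sigma> x)))
     (\<lambda>\<alpha>. ren_stk Suc id (sv \<sigma> \<alpha>))
     (\<lambda>a. ren_trm Suc id (tv \<sigma> a))"

definition up_sv :: "('l, 'c) subst \<Rightarrow> ('l, 'c) subst" where
  "up_sv \<sigma> = Subst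
     (\<lambda>x. ren_val id Suc (lv \<sigma> x))
     (case_nat (SVar 0) (\<lambda>\<alpha>. ren_stk id Suc (sv \<sigma> \<alpha>)))
     (\<lambda>a. ren_trm id Suc (tv \<sigma> a))"

primrec subst_val :: "('l, 'c) subst \<Rightarrow> ('l, 'c) val \<Rightarrow> ('l, 'c) val"
  and subst_trm :: "('l, 'c) subst \<Rightarrow> ('l, 'c) trm \<Rightarrow> ('l, 'c) trm"
  and subst_stk :: "('l, 'c) subst \<Rightarrow> ('l, 'c) stk \<Rightarrow> ('l, 'c) stk"
  and subst_prc :: "('l, 'c) subst \<Rightarrow> ('l, 'c) prc \<Rightarrow> ('l, 'c) prc"
where
  "subst_val \<sigma> (Var x) = lv \<sigma> x"
| "subst_val \<sigma> (Lam t) = Lam (subst_trm (up_lv \<sigma>) t)"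
| "subst_val \<sigma> (Con C v) = Con C (subst_val \<sigma> v)"
| "subst_val \<sigma> (Rec r) = Rec (fmmap (subst_val \<sigma>) r)"
| "subst_trm \<sigma> (TVar a) = tv \<sigma> a"
| "subst_trm \<sigma> (Val v) = Val (subst_val \<sigma> v)"
| "subst_trm \<sigma> (App t u) = App (subst_trm \<sigma> t) (subst_trm \<sigma> u)"
| "subst_trm \<sigma> (Mu t) = Mu (subst_trm (up_sv \<sigma>) t)"
| "subst_trm \<sigma> (Prc p) = Prc (subst_prc \<sigma> p)"
| "subst_trm \<sigma> (Proj v l) = Proj (subst_val \<sigma> v) l"
| "subst_trm \<sigma> (Case v bs) = Case (subst_val \<sigma> v) (fmmap (subst_trm (up_lv \<sigma>)) bs)"
| "subst_trm \<sigma> (Delta v w) = Delta (subst_val \<sigma> v) (subst_val \<sigma> w)"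
| "subst_stk \<sigma> (SVar \<alpha>) = sv \<sigma> \<alpha>"
| "subst_stk \<sigma> (Push v \<pi>) = Push (subst_val \<sigma> v) (subst_stk \<sigma> \<pi>)"
| "subst_stk \<sigma> (Frame t \<pi>) = Frame (subst_trm \<sigma> t) (subst_stk \<sigma> \<pi>)"
| "subst_prc \<sigma> (t \<star> \<pi>) = subst_trm \<sigma> t \<star> subst_stk \<sigma> \<pi>"

text \<open>
  \<open>single_lv x v\<close> is the substitution \<open>[x := v]\<close> of a free \<open>\<lambda>\<close>-variable; all other variables are
  left alone. By contrast, \<open>open_lv v\<close> and \<open>open_sv \<pi>\<close> instantiate the variable of a binder that
  has just been removed, so the remaining indices of that kind go down by one.
\<close>

definition single_lv :: "nat \<Rightarrow> ('l, 'c) val \<Rightarrow> ('l, 'c) subst" where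
  "single_lv x v = Subst (Var(x := v)) SVar TVar"

definition open_lv :: "('l, 'c) val \<Rightarrow> ('l, 'c) subst" where
  "open_lv v = Subst (case_nat v Var) SVar TVar"

definition open_sv :: "('l, 'c) stk \<Rightarrow> ('l, 'c) subst" where
  "open_sv \<pi> = Subst Var (case_nat \<pi> SVar) TVar"

inductive step :: "('l, 'c) prc \<Rightarrow> ('l, 'c) prc \<Rightarrow> bool"  (infix \<open>\<succ>\<close> 50) where
  step_App: "App t u \<star> \<pi> \<succ> u \<star> Frame t \<pi>"
| step_Frame: "Val v \<star> Frame t \<pi> \<succ> t \<star> Push v \<pi>"
| step_Lam: "Val (Lam t) \<star> Push v \<pi> \<succ> subst_trm (open_lv v) t \<star> \<pi>"
| step_Mu: "Mu t \<star> \<pi> \<succ> subst_trm (open_sv \<pi>) t \<star> \<pi>"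
| step_Prc: "Prc p \<star> \<pi> \<succ> p"
| step_Proj: "fmlookup r l = Some v \<Longrightarrow> Proj (Rec r) l \<star> \<pi> \<succ> Val v \<star> \<pi>"
| step_Case: "fmlookup bs C = Some t \<Longrightarrow> Case (Con C v) bs \<star> \<pi> \<succ> subst_trm (open_lv v) t \<star> \<pi>"

definition final :: "('l, 'c) prc \<Rightarrow> bool" where
  "final p \<longleftrightarrow> (\<exists>v \<alpha>. p = Val v \<star> SVar \<alpha>)"

definition converges ::
    "(('l, 'c) prc \<Rightarrow> ('l, 'c) prc \<Rightarrow> bool) \<Rightarrow> ('l, 'c) prc \<Rightarrow> bool" where
  "converges R p \<longleftrightarrow> (\<exists>q. R\<^sup>*\<^sup>* p q \<and> final q)"

text \<open>
  The conjunction congruence lets the termination proof see \<open>j < i\<close> in the call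
  \<open>equiv_at j\<close> below.
\<close>

context
  notes conj_cong [fundef_cong]
begin

function red :: "nat \<Rightarrow> ('l, 'c) prc \<Rightarrow> ('l, 'c) prc \<Rightarrow> bool"
  and equiv_at :: "nat \<Rightarrow> ('l, 'c) trm \<Rightarrow> ('l, 'c) trm \<Rightarrow> bool"
where
  "red i = (\<lambda>p q. p \<succ> q \<or>
     (\<exists>v w \<pi>. p = Delta v w \<star> \<pi> \<and> q = Val v \<star> \<pi> \<and>
        (\<exists>j<i. \<not> equiv_at j (Val v) (Val w))))"
| "equiv_at i = (\<lambda>t u. \<forall>j\<le>i. \<forall>\<pi> \<sigma>.
     converges (red j) (subst_trm \<sigma> t \<star> \<pi>) \<longleftrightarrow> converges (red j) (subst_trm \<sigma> u \<star> \<pi>))"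
  by pat_completeness auto
termination
  by (relation "measure (case_sum (\<lambda>i. 2 * i) (\<lambda>i. 2 * i + 1))") auto

end

declare red.simps [simp del] equiv_at.simps [simp del]

definition obs_equiv :: "('l, 'c) trm \<Rightarrow> ('l, 'c) trm \<Rightarrow> bool"  (infix \<open>\<approx>\<close> 50) where
  "t \<approx> u \<longleftrightarrow> (\<forall>i. equiv_at i t u)"

end

theory Submission
  imports Defs
begin

text \<open>
  The stack \<open>[\<lambda>x E\<sigma>]\<pi>\<close> turns any context into an observer of values: the process
  \<open>v\<sigma> \<star> [\<lambda>x E\<sigma>]\<pi>\<close> has a forced two-step reduction to \<open>E\<sigma>[x := v\<sigma>] \<star> \<pi>\<close>, which is
  \<open>(E[x := v])\<sigma> \<star> \<pi>\<close> once \<open>x\<close> is chosen outside \<open>\<sigma>\<close>. So convergence of the latter is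
  already tested, at the same index, by the definition of \<open>v \<equiv> w\<close>.
\<close>

lemma up_comp: "up f (up f' n) = up (\<lambda>n. f (f' n)) n"
  by (simp add: up_def split: nat.split)

lemma up_Suc [simp]: "up f (Suc n) = Suc (f n)" and up_0 [simp]: "up f 0 = 0"
  by (simp_all add: up_def)

text \<open>Lifting a substitution renames its range, so composition is built up from renamings:
  \<open>ren_subst\<close> rests on this law, and \<open>subst_subst\<close> on
  \<open>subst_ren\<close> and \<open>ren_subst\<close>.\<close>

lemma ren_ren:
  fixes v :: "('l, 'c) val" and t :: "('l, 'c) trm"
    and \<pi> :: "('l, 'c) stk" and p :: "('l, 'c) prc"
  shows
    "ren_val f g (ren_val f' g' v) = ren_val (\<lambda>n. f (f' n)) (\<lambda>n. g (g' n)) v"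
    "ren_trm f g (ren_trm f' g' t) = ren_trm (\<lambda>n. f (f' n)) (\<lambda>n. g (g' n)) t"
    "ren_stk f g (ren_stk f' g' \<pi>) = ren_stk (\<lambda>n. f (f' n)) (\<lambda>n. g (g' n)) \<pi>"
    "ren_prc f g (ren_prc f' g' p) = ren_prc (\<lambda>n. f (f' n)) (\<lambda>n. g (g' n)) p"
  by (induction v and t and \<pi> and p arbitrary: f g f' g' and f g f' g' and f g f' g' and f g f' g')
    (auto simp: up_comp fmap.map_comp intro!: fmap.map_cong)

definition subst_comp_ren where
  "subst_comp_ren \<sigma> f g = Subst (\<lambda>x. lv \<sigma> (f x)) (\<lambda>\<alpha>. sv \<sigma> (g \<alpha>)) (tv \<sigma>)"

lemma up_subst_comp_ren:
  "subst_comp_ren (up_lv \<sigma>) (up f) g = up_lv (subst_comp_ren \<sigma> f g)"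
  "subst_comp_ren (up_sv \<sigma>) f (up g) = up_sv (subst_comp_ren \<sigma> f g)"
  by (auto simp: subst_comp_ren_def up_lv_def up_sv_def fun_eq_iff split: nat.split)

lemma subst_ren:
  fixes v :: "('l, 'c) val" and t :: "('l, 'c) trm"
    and \<pi> :: "('l, 'c) stk" and p :: "('l, 'c) prc"
  shows
    "subst_val \<sigma> (ren_val f g v) = subst_val (subst_comp_ren \<sigma> f g) v"
    "subst_trm \<sigma> (ren_trm f g t) = subst_trm (subst_comp_ren \<sigma> f g) t"
    "subst_stk \<sigma> (ren_stk f g \<pi>) = subst_stk (subst_comp_ren \<sigma> f g) \<pi>"
    "subst_prc \<sigma> (ren_prc f g p) = subst_prc (subst_comp_ren \<sigma> f g) p"
proof (induction v and t and \<pi> and p arbitrary: f g \<sigma> and f g \<sigma> and f g \<sigma> and f g \<sigma>)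
\<comment> \<open>The composite stays folded while the binder cases are rewritten; it is unfolded
  only afterwards, for the variables.\<close>
qed (auto simp: up_subst_comp_ren fmap.map_comp intro!: fmap.map_cong,
      auto simp: subst_comp_ren_def)

definition ren_comp_subst where
  "ren_comp_subst f g \<sigma> =
     Subst (\<lambda>x. ren_val f g (lv \<sigma> x)) (\<lambda>\<alpha>. ren_stk f g (sv \<sigma> \<alpha>)) (\<lambda>a. ren_trm f g (tv \<sigma> a))"

lemma up_ren_comp_subst:
  "ren_comp_subst (up f) g (up_lv \<sigma>) = up_lv (ren_comp_subst f g \<sigma>)"
  "ren_comp_subst f (up g) (up_sv \<sigma>) = up_sv (ren_comp_subst f g \<sigma>)"
  by (auto simp: ren_comp_subst_def up_lv_def up_sv_def fun_eq_iff ren_ren split: nat.split)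

lemma ren_subst:
  fixes v :: "('l, 'c) val" and t :: "('l, 'c) trm"
    and \<pi> :: "('l, 'c) stk" and p :: "('l, 'c) prc"
  shows
    "ren_val f g (subst_val \<sigma> v) = subst_val (ren_comp_subst f g \<sigma>) v"
    "ren_trm f g (subst_trm \<sigma> t) = subst_trm (ren_comp_subst f g \<sigma>) t"
    "ren_stk f g (subst_stk \<sigma> \<pi>) = subst_stk (ren_comp_subst f g \<sigma>) \<pi>"
    "ren_prc f g (subst_prc \<sigma> p) = subst_prc (ren_comp_subst f g \<sigma>) p"
proof (induction v and t and \<pi> and p arbitrary: f g \<sigma> and f g \<sigma> and f g \<sigma> and f g \<sigma>)
qed (auto simp: up_ren_comp_subst fmap.map_comp intro!: fmap.map_cong,
      auto simp: ren_comp_subst_def)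

definition subst_comp where
  "subst_comp \<sigma> \<tau> =
     Subst (\<lambda>x. subst_val \<sigma> (lv \<tau> x)) (\<lambda>\<alpha>. subst_stk \<sigma> (sv \<tau> \<alpha>)) (\<lambda>a. subst_trm \<sigma> (tv \<tau> a))"

text \<open>After a shift the index \<open>0\<close> is never looked up, and at \<open>Suc n\<close>
  a lifted substitution returns the shifted image of \<open>n\<close>.\<close>

lemma subst_comp_ren_shift:
  "subst_comp_ren (up_lv \<sigma>) Suc id = ren_comp_subst Suc id \<sigma>"
  "subst_comp_ren (up_sv \<sigma>) id Suc = ren_comp_subst id Suc \<sigma>"
  by (auto simp: subst_comp_ren_def ren_comp_subst_def up_lv_def up_sv_def)

lemma up_subst_comp:
  "subst_comp (up_lv \<sigma>) (up_lv \<tau>) = up_lv (subst_comp \<sigma> \<tau>)"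
  "subst_comp (up_sv \<sigma>) (up_sv \<tau>) = up_sv (subst_comp \<sigma> \<tau>)"
  \<comment> \<open>Only the lifting of \<tau> is unfolded, so that the lifted \<sigma> meets the
    shifted range of \<tau> in the form that \<open>subst_comp_ren_shift\<close> rewrites. The index
    \<open>0\<close> is left for the last call.\<close>
  by (simp_all add: subst_comp_def up_lv_def [of \<tau>] up_sv_def [of \<tau>]
      up_lv_def [of "Subst _ _ _"] up_sv_def [of "Subst _ _ _"]
      subst_ren ren_subst subst_comp_ren_shift fun_eq_iff split: nat.split)
    (simp_all add: up_lv_def up_sv_def)

lemma subst_subst:
  fixes v :: "('l, 'c) val" and t :: "('l, 'c) trm"
    and \<pi> :: "('l, 'c) stk" and p :: "('l, 'c) prc"
  shows
    "subst_val \<sigma> (subst_val \<tau> v) = subst_val (subst_comp \<sigma> \<tau>) v"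
    "subst_trm \<sigma> (subst_trm \<tau> t) = subst_trm (subst_comp \<sigma> \<tau>) t"
    "subst_stk \<sigma> (subst_stk \<tau> \<pi>) = subst_stk (subst_comp \<sigma> \<tau>) \<pi>"
    "subst_prc \<sigma> (subst_prc \<tau> p) = subst_prc (subst_comp \<sigma> \<tau>) p"
proof (induction v and t and \<pi> and p arbitrary: \<sigma> \<tau> and \<sigma> \<tau> and \<sigma> \<tau> and \<sigma> \<tau>)
qed (auto simp: up_subst_comp fmap.map_comp intro!: fmap.map_cong,
      auto simp: subst_comp_def)

lemma up_subst_id:
  "up_lv (Subst Var SVar TVar) = Subst Var SVar TVar"
  "up_sv (Subst Var SVar TVar) = Subst Var SVar TVar"
  by (auto simp: up_lv_def up_sv_def fun_eq_iff split: nat.split)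

lemma subst_id [simp]:
  fixes v :: "('l, 'c) val" and t :: "('l, 'c) trm"
    and \<pi> :: "('l, 'c) stk" and p :: "('l, 'c) prc"
  shows
    "subst_val (Subst Var SVar TVar) v = v"
    "subst_trm (Subst Var SVar TVar) t = t"
    "subst_stk (Subst Var SVar TVar) \<pi> = \<pi>"
    "subst_prc (Subst Var SVar TVar) p = p"
  by (induction v and t and \<pi> and p)
    \<comment> \<open>For records and branches, the map is compared pointwise with
      \<open>id\<close>.\<close>
    (auto simp: up_subst_id intro!: trans [OF fmap.map_cong fmap.map_id])

text \<open>A shifted expression does not contain the index \<open>0\<close>, so \<open>u\<close> is
  inserted nowhere and the other indices return to their places.\<close>

lemma open_lv_shift:
  "subst_val (open_lv u) (ren_val Suc id v) = v"
  "subst_stk (open_lv u) (ren_stk Suc id \<pi>) = \<pi>"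
  "subst_trm (open_lv u) (ren_trm Suc id t) = t"
  by (simp_all add: subst_ren subst_comp_ren_def open_lv_def)

text \<open>Shifting the range of \<open>\<sigma>\<close> is what makes \<open>x\<close>, now the index \<open>0\<close> of the new binder, fresh for \<open>\<sigma>\<close>.\<close>

definition abstract_subst where
  "abstract_subst x \<sigma> = Subst ((\<lambda>y. ren_val Suc id (lv \<sigma> y))(x := Var 0))
     (\<lambda>\<alpha>. ren_stk Suc id (sv \<sigma> \<alpha>)) (\<lambda>a. ren_trm Suc id (tv \<sigma> a))"

text \<open>This isolates the dependence on \<open>v\<close>: on the right it occurs only in the
  opening, so the term being opened is the same for \<open>v\<close> and for
  \<open>w\<close>.\<close>

lemma subst_single_lv:
  "subst_trm \<sigma> (subst_trm (single_lv x v) E) =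
     subst_trm (open_lv (subst_val \<sigma> v)) (subst_trm (abstract_subst x \<sigma>) E)"
proof -
  \<comment> \<open>The composites are compared variable by variable: at \<open>x\<close> both give
    \<open>subst_val \<sigma> v\<close>, and elsewhere opening cancels the shift.\<close>
  have "subst_comp \<sigma> (single_lv x v) =
      subst_comp (open_lv (subst_val \<sigma> v)) (abstract_subst x \<sigma>)"
    by (auto simp: subst_comp_def single_lv_def abstract_subst_def open_lv_shift fun_eq_iff)
      (simp add: open_lv_def)
  then show ?thesis
    by (simp add: subst_subst)
qed

text \<open>A process that is not final must take at least one step to converge, and that step can
  only lead to \<open>p'\<close>.\<close>

lemma converges_unique_step:
  assumes "\<And>q. R p q \<longleftrightarrow> q = p'" and "\<not> final p"
  shows "converges R p \<longleftrightarrow> converges R p'"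
  using assms unfolding converges_def by (metis converse_rtranclp_into_rtranclp converse_rtranclpE)

text \<open>Neither intermediate head is a \<open>Delta\<close>, so both steps are forced at every
  level \<open>j\<close>; neither stack is a variable, so no run ends early.\<close>

lemma converges_Frame_Lam:
  "converges (red j) (Val v \<star> Frame (Val (Lam t)) \<pi>) \<longleftrightarrow>
     converges (red j) (subst_trm (open_lv v) t \<star> \<pi>)"
proof -
  have "red j (Val v \<star> Frame (Val (Lam t)) \<pi>) q \<longleftrightarrow> q = Val (Lam t) \<star> Push v \<pi>"
    and "red j (Val (Lam t) \<star> Push v \<pi>) q \<longleftrightarrow> q = subst_trm (open_lv v) t \<star> \<pi>" for q
    by (auto simp: red.simps intro: step.intros elim: step.cases)
  then show ?thesis
    by (simp add: converges_unique_step final_def)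
qed

theorem theorem2:
  fixes v w :: "('l::countable, 'c::countable) val"
    and E :: "('l, 'c) trm"
    and x :: nat
  assumes "Val v \<approx> Val w"
  shows "subst_trm (single_lv x v) E \<approx> subst_trm (single_lv x w) E"
proof -
  \<comment> \<open>Level \<open>j\<close> of the assumption, with its bound taken as
    \<open>j\<close> itself.\<close>
  have "converges (red j) (Val (subst_val \<sigma> v) \<star> \<pi>) \<longleftrightarrow>
      converges (red j) (Val (subst_val \<sigma> w) \<star> \<pi>)" for j \<sigma> \<pi>
    using assms by (auto simp: obs_equiv_def equiv_at.simps)
  then have "converges (red j) (subst_trm \<sigma> (subst_trm (single_lv x v) E) \<star> \<pi>) \<longleftrightarrow>
      converges (red j) (subst_trm \<sigma> (subst_trm (single_lv x w) E) \<star> \<pi>)" for j \<sigma> \<pi>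
    \<comment> \<open>Read backwards, the two steps put both values in front of one common stack,
      \<open>Frame (Val (Lam t)) \<pi>\<close> with
      \<open>t = subst_trm (abstract_subst x \<sigma>) E\<close>.\<close>
    by (simp only: subst_single_lv converges_Frame_Lam [symmetric])
  then show ?thesis
    by (simp add: obs_equiv_def equiv_at.simps)
qed

end
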